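(* Let $\mathcal{V},\mathcal{W}$ be separable Hilbert spaces, $A:\mathcal{V}\to\mathcal{W}$ a bounded linear operator, $d\in\mathcal{W}$, and let $f$ be a $[0,\infty]$-valued functional on $\mathcal{V}$. Set $$\mathcal{J}(x)=f(x)+\frac12\|Ax-d\|_{\mathcal{W}}^2,\qquad \mathcal{J}_\gamma(x)=\mathcal{S}_\gamma^2(f)(x)+\frac12\|Ax-d\|_{\mathcal{W}}^2,\qquad x\in\mathcal{V}.$$ For $\gamma>0$ such that $A^*A\geq\gamma I$, $\mathcal{J}_\gamma$ is convex and $\mathcal{J}_\gamma\leq CE(\mathcal{J})$. Moreover, if $A^*A>\gamma I$, then $\mathcal{J}_\gamma$ is strongly convex, in which case it has a unique minimizer. Finally, a minimizer $\hat x$ of $\mathcal{J}_\gamma$ is a minimizer of $\mathcal{J}$ whenever $f(\hat x)=\mathcal{S}_\gamma^2(f)(\hat x)$.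
   Context: Hilbert spaces are over $\mathbb{R}$ or $\mathbb{C}$; complex ones are regarded as real Hilbert spaces with scalar product $\mathrm{Re}\langle x,y\rangle$. For an extended-real-valued functional $g$ on $\mathcal{V}$ and $\gamma>0$, $\mathcal{S}_\gamma(g)(y)=\sup_{x\in\mathcal{V}}\left(-g(x)-\frac{\gamma}{2}\|x-y\|_{\mathcal{V}}^2\right)$ and $\mathcal{S}_\gamma^2=\mathcal{S}_\gamma\circ\mathcal{S}_\gamma$. $CE(g)$ is the lower semi-continuous convex envelope of $g$, i.e. its largest lower semi-continuous convex minorant. $A^*A\ge\gamma I$ means that $\langle x,y\rangle_{\mathcal{U}}=\langle Ax,Ay\rangle_{\mathcal{W}}-\gamma\langle x,y\rangle_{\mathcal{V}}$ is a semi-inner product, i.e. $\|Ax\|_{\mathcal{W}}^2\ge\gamma\|x\|_{\mathcal{V}}^2$ for all $x\in\mathcal{V}$; $A^*A>\gamma I$ means that the inequality is strict, so that this is an inner product, i.e. $\|Ax\|_{\mathcal{W}}^2>\gamma\|x\|_{\mathcal{V}}^2$ for all $x\neq0$.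
   Formalization: Under pointwise A*A > γI, strong convexity is proved for the norm of ⟨·,·⟩_U, and for the norm of V only if V is finite-dimensional or A*A ≥ δI for some δ > γ (it can fail otherwise); the unique minimizer needs f not identically ∞. *)

theory Defs
  imports "HOL-Analysis.Analysis"
begin

text \<open>
  Hilbert spaces are types of class \<open>{real_inner, complete_space}\<close>.  A complex Hilbert space
  is regarded as a real one with the inner product Re <x, y>; the norm is unchanged, and a bounded
  complex-linear operator is in particular bounded real-linear.

  Functionals take values in \<open>ereal\<close>.  All sums and differences written below have at most
  one infinite summand when they are applied to functionals with values in [0,\<infinity>], so no
  \<open>\<infinity> - \<infinity>\<close> arises.
\<close>

definition S_trans :: "real \<Rightarrow> ('v::real_inner \<Rightarrow> ereal) \<Rightarrow> 'v \<Rightarrow> ereal" where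
  "S_trans \<gamma> g y = (SUP x. - g x - ereal (\<gamma> / 2 * (norm (x - y))\<^sup>2))"

definition S2_trans :: "real \<Rightarrow> ('v::real_inner \<Rightarrow> ereal) \<Rightarrow> 'v \<Rightarrow> ereal" where
  "S2_trans \<gamma> = S_trans \<gamma> \<circ> S_trans \<gamma>"

definition plus_lsq ::
  "('v::real_inner \<Rightarrow> ereal) \<Rightarrow> ('v \<Rightarrow> 'w::real_inner) \<Rightarrow> 'w \<Rightarrow> 'v \<Rightarrow> ereal" where
  "plus_lsq g A d x = g x + ereal (1 / 2 * (norm (A x - d))\<^sup>2)"

text \<open>Convexity of extended-real-valued functionals is convexity of the epigraph, so that the
  values \<open>\<infinity>\<close> and \<open>-\<infinity>\<close> need no special treatment.\<close>

definition ext_convex :: "('v::real_vector \<Rightarrow> ereal) \<Rightarrow> bool" where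
  "ext_convex F \<longleftrightarrow> convex {(x, r::real). F x \<le> ereal r}"

definition lsc :: "('v::topological_space \<Rightarrow> ereal) \<Rightarrow> bool" where
  "lsc F \<longleftrightarrow> (\<forall>x. \<forall>a < F x. eventually (\<lambda>y. a < F y) (nhds x))"

text \<open>The order on functionals is the pointwise one; the lemma \<open>CE_greatest\<close> below
  shows that the largest element always exists.\<close>

definition CE :: "('v::real_normed_vector \<Rightarrow> ereal) \<Rightarrow> 'v \<Rightarrow> ereal" where
  "CE g = (GREATEST h. lsc h \<and> ext_convex h \<and> h \<le> g)"

definition gram_ge :: "('v::real_inner \<Rightarrow> 'w::real_inner) \<Rightarrow> real \<Rightarrow> bool" where
  "gram_ge A \<gamma> \<longleftrightarrow> (\<forall>x. (norm (A x))\<^sup>2 \<ge> \<gamma> * (norm x)\<^sup>2)"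

text \<open>The strict inequality is pointwise; in infinite dimension it does not give
  \<open>gram_ge A \<delta>\<close> for any \<open>\<delta> > \<gamma>\<close>.\<close>

definition gram_gt :: "('v::real_inner \<Rightarrow> 'w::real_inner) \<Rightarrow> real \<Rightarrow> bool" where
  "gram_gt A \<gamma> \<longleftrightarrow> (\<forall>x. x \<noteq> 0 \<longrightarrow> (norm (A x))\<^sup>2 > \<gamma> * (norm x)\<^sup>2)"

definition U_inner :: "('v::real_inner \<Rightarrow> 'w::real_inner) \<Rightarrow> real \<Rightarrow> 'v \<Rightarrow> 'v \<Rightarrow> real" where
  "U_inner A \<gamma> x y = inner (A x) (A y) - \<gamma> * inner x y"

text \<open>A norm if \<open>A\<close> is linear and \<open>gram_gt A \<gamma>\<close>; in finite
  dimension it is then equivalent to the norm of the space.\<close>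

definition U_norm :: "('v::real_inner \<Rightarrow> 'w::real_inner) \<Rightarrow> real \<Rightarrow> 'v \<Rightarrow> real" where
  "U_norm A \<gamma> x = sqrt (U_inner A \<gamma> x x)"

text \<open>Strong convexity with respect to a norm \<open>N\<close>, with some modulus
  \<open>\<mu> > 0\<close>.\<close>

definition strongly_convex_wrt ::
  "('v::real_vector \<Rightarrow> real) \<Rightarrow> ('v \<Rightarrow> ereal) \<Rightarrow> bool" where
  "strongly_convex_wrt N F \<longleftrightarrow>
     (\<exists>\<mu>>0. \<forall>x y. \<forall>t\<in>{0<..<1}.
        F (t *\<^sub>R x + (1 - t) *\<^sub>R y) + ereal (\<mu> / 2 * t * (1 - t) * (N (x - y))\<^sup>2)
          \<le> ereal t * F x + ereal (1 - t) * F y)"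

abbreviation minimizer :: "('v \<Rightarrow> ereal) \<Rightarrow> 'v \<Rightarrow> bool" where
  "minimizer F \<equiv> is_arg_min F (\<lambda>_. True)"

lemma lsc_SUP:
  assumes "\<And>h. h \<in> H \<Longrightarrow> lsc h"
  shows "lsc (Sup H)"
  unfolding lsc_def
proof (intro allI impI)
  fix x a assume "a < Sup H x"
  then obtain h where h: "h \<in> H" "a < h x"
    by (auto simp: less_SUP_iff)
  from assms[OF h(1)] h(2) have "eventually (\<lambda>y. a < h y) (nhds x)"
    by (auto simp: lsc_def)
  then show "eventually (\<lambda>y. a < Sup H y) (nhds x)"
    by eventually_elim (use h(1) in \<open>auto simp: less_SUP_iff\<close>)
qed

lemma ext_convex_SUP:
  assumes "\<And>h. h \<in> H \<Longrightarrow> ext_convex h"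
  shows "ext_convex (Sup H)"
proof -
  have "{(x, r::real). Sup H x \<le> ereal r} = (\<Inter>h\<in>H. {(x, r). h x \<le> ereal r})"
    by (auto simp: SUP_le_iff)
  then show ?thesis
    using assms by (auto simp: ext_convex_def intro!: convex_INT)
qed

lemma CE_eq: "CE g = Sup {h. lsc h \<and> ext_convex h \<and> h \<le> g}"
  unfolding CE_def
  by (rule Greatest_equality)
     (auto intro!: lsc_SUP ext_convex_SUP Sup_least Sup_upper)

lemma CE_greatest:
  "lsc (CE g)" "ext_convex (CE g)" "CE g \<le> g"
  "lsc h \<Longrightarrow> ext_convex h \<Longrightarrow> h \<le> g \<Longrightarrow> h \<le> CE g"
  unfolding CE_eq by (auto intro!: lsc_SUP ext_convex_SUP Sup_least Sup_upper)

end

theory Submission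
  imports Defs
begin

text \<open>
  Both applications of \<open>S_trans \<gamma>\<close> are suprema, so \<open>J\<gamma>\<close> is the supremum over \<open>w\<close> of the functions
  \<open>x \<mapsto> c w + (1/2 * \<parallel>A x - d\<parallel>\<^sup>2 - \<gamma>/2 * \<parallel>w - x\<parallel>\<^sup>2)\<close>.  The real part of each of them is a
  quadratic function with Hessian \<open>A\<^sup>*A - \<gamma>I\<close>, so (strong) convexity holds with the same modulus for
  each \<open>w\<close> and passes to the supremum, as does lower semi-continuity.  The minimizer exists because
  \<open>J\<gamma> x \<ge> 1/2 * \<parallel>A x - d\<parallel>\<^sup>2\<close> and \<open>A\<close> is bounded below, so that the sublevel sets are
  closed, convex and bounded, and nested sets of this kind have a common point.
\<close>

section \<open>Minimizers of convex functionals\<close>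

lemma lsc_closed_sublevel:
  assumes "lsc F"
  shows "closed {x. F x \<le> a}"
proof -
  have "open {x. a < F x}"
    unfolding open_subopen[of "{x. a < F x}"]
    using assms unfolding lsc_def eventually_nhds by fastforce
  moreover have "{x. F x \<le> a} = - {x. a < F x}" by auto
  ultimately show ?thesis by (simp add: closed_def)
qed

text \<open>At a real level the sublevel set is a slice of the convex epigraph; at level
  \<open>-\<infinity>\<close> it is the intersection of all real sublevel sets.\<close>

lemma ext_convex_convex_sublevel:
  fixes F :: "'a::real_vector \<Rightarrow> ereal"
  assumes "ext_convex F"
  shows "convex {x. F x \<le> a}"
proof -
  have real: "convex {x. F x \<le> ereal r}" for r
  proof (rule convexI)
    fix x y u v assume *: "x \<in> {x. F x \<le> ereal r}" "y \<in> {x. F x \<le> ereal r}"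
      "0 \<le> u" "0 \<le> v" "u + v = (1::real)"
    have "u *\<^sub>R (x, r) + v *\<^sub>R (y, r) \<in> {(x, r). F x \<le> ereal r}"
      using assms * unfolding ext_convex_def by (intro convexD) auto
    moreover have "u * r + v * r = r" using * by (metis distrib_right mult_1)
    ultimately show "u *\<^sub>R x + v *\<^sub>R y \<in> {x. F x \<le> ereal r}" by simp
  qed
  have "{x. F x \<le> -\<infinity>} = (\<Inter>r. {x. F x \<le> ereal r})"
    by (auto intro: ereal_bot)
  then have "convex {x. F x \<le> -\<infinity>}" using real by (auto intro: convex_INT)
  with real show ?thesis by (cases a) auto
qed

text \<open>A substitute for weak compactness: points of almost minimal norm in \<open>C n\<close>
  form a Cauchy sequence, whose limit lies in every \<open>C n\<close>. The least squared norms
  \<open>m n\<close> converge, being increasing and bounded.\<close>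

lemma decseq_closed_convex_bounded_Inter:
  fixes C :: "nat \<Rightarrow> 'a::{real_inner, complete_space} set"
  assumes "decseq C" and closed: "\<And>n. closed (C n)" and conv: "\<And>n. convex (C n)"
    and ne: "\<And>n. C n \<noteq> {}" and bdd: "bounded (C 0)"
  shows "(\<Inter>n. C n) \<noteq> {}"
proof -
  have sub: "C k \<subseteq> C n" if "n \<le> k" for n k using \<open>decseq C\<close> that by (auto simp: decseq_def)
  define m where "m n = (INF x\<in>C n. (norm x)\<^sup>2)" for n
  have bb: "bdd_below ((\<lambda>x. (norm x)\<^sup>2) ` C n)" for n by (rule bdd_belowI[of _ 0]) auto
  have lower: "m n \<le> (norm x)\<^sup>2" if "x \<in> C n" for n x
    unfolding m_def using bb that by (rule cINF_lower)
  \<comment> \<open>The slack \<open>1 / Suc n\<close> avoids having to attain the infimum and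
    vanishes in the limit.\<close>
  have "\<exists>x\<in>C n. (norm x)\<^sup>2 < m n + 1 / Suc n" for n
    unfolding m_def by (rule cInf_lessD[of "(\<lambda>x. (norm x)\<^sup>2) ` C n", simplified]) (use ne in auto)
  then obtain x where x: "\<And>n. x n \<in> C n" "\<And>n. (norm (x n))\<^sup>2 < m n + 1 / Suc n" by metis
  have "incseq m"
  proof (rule incseq_SucI)
    fix n show "m n \<le> m (Suc n)"
      unfolding m_def using sub[of n "Suc n"] ne bb by (intro cINF_superset_mono) auto
  qed
  moreover obtain M where "\<And>x. x \<in> C 0 \<Longrightarrow> norm x \<le> M" using bdd by (auto simp: bounded_iff)
  then have "m n \<le> M\<^sup>2" for n
    using lower[OF x(1)[of n]] sub[of 0 n] x(1)[of n]
    by (meson norm_ge_zero order_trans power_mono subsetD le0)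
  ultimately obtain L where L: "m \<longlonglongrightarrow> L" "\<And>n. m n \<le> L"
    using incseq_convergent[of m "M\<^sup>2"] by blast
  \<comment> \<open>Parallelogram identity: the midpoint of \<open>x n\<close> and \<open>x k\<close> lies in \<open>C n\<close>.\<close>
  have dist: "(dist (x n) (x k))\<^sup>2 \<le> 4 * (L - m n) + 4 / Suc n" if "n \<le> k" for n k
  proof -
    have "(1/2) *\<^sub>R x n + (1/2) *\<^sub>R x k \<in> C n"
      using conv x(1) sub[OF that] by (intro convexD) auto
    from lower[OF this] have "4 * m n \<le> (norm (x n + x k))\<^sup>2"
      by (simp flip: scaleR_right_distrib add: power_mult_distrib power_divide)
    moreover have "(norm (x n + x k))\<^sup>2 + (norm (x n - x k))\<^sup>2 = 2 * (norm (x n))\<^sup>2 + 2 * (norm (x k))\<^sup>2"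
      by (simp add: power2_norm_eq_inner algebra_simps)
    moreover have "1 / real (Suc k) \<le> 1 / Suc n" using that by (simp add: frac_le)
    ultimately show ?thesis using x(2)[of n] x(2)[of k] L(2)[of k] L(2)[of n] unfolding dist_norm by simp
  qed
  have "Cauchy x"
  proof (rule CauchyI')
    fix e :: real assume "e > 0"
    have "(\<lambda>n. 4 * (L - m n) + 4 / Suc n) \<longlonglongrightarrow> 4 * (L - L) + 4 * 0"
      using LIMSEQ_Suc[OF lim_const_over_n[of 4]] by (intro tendsto_intros L) simp
    then have "eventually (\<lambda>n. 4 * (L - m n) + 4 / Suc n < e\<^sup>2) sequentially"
      using \<open>e > 0\<close> by (intro order_tendstoD(2)[where a = "e\<^sup>2"]) auto
    then obtain N where N: "\<And>n. n \<ge> N \<Longrightarrow> 4 * (L - m n) + 4 / Suc n < e\<^sup>2"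
      by (auto simp: eventually_sequentially)
    have "dist (x n) (x k) < e" if "n \<ge> N" "n < k" for n k
      using dist[of n k] N[of n] that \<open>e > 0\<close>
      by (intro power_less_imp_less_base[of _ 2 e]) auto
    then show "\<exists>M. \<forall>m\<ge>M. \<forall>n>m. dist (x m) (x n) < e" by blast
  qed
  then obtain l where l: "x \<longlonglongrightarrow> l" using Cauchy_convergent convergent_def by blast
  have "l \<in> C n" for n
  proof (rule Lim_in_closed_set[OF closed _ _ l])
    show "eventually (\<lambda>k. x k \<in> C n) sequentially"
      using eventually_ge_at_top[of n] by eventually_elim (use x(1) sub in blast)
  qed simp
  then show ?thesis by blast
qed

text \<open>A minimizer is a common point of the sublevel sets at levels decreasing to the infimum;
  these sets are nested, closed, convex and bounded.\<close>

lemma ext_convex_minimizer_exists: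
  fixes F :: "'a::{real_inner, complete_space} \<Rightarrow> ereal"
  assumes "lsc F" and "ext_convex F" and bdd: "\<And>r. bounded {x. F x \<le> ereal r}"
    and "F x0 \<noteq> \<infinity>"
  shows "\<exists>x. minimizer F x"
proof -
  \<comment> \<open>The levels are values of \<open>F\<close> below \<open>\<infinity>\<close>: each
    sublevel set is then nonempty, and the largest, at \<open>u 0\<close>, lies in one at a real
    level.\<close>
  have "F ` {x. F x < \<infinity>} \<noteq> {}" using \<open>F x0 \<noteq> \<infinity>\<close> by auto
  from Inf_countable_INF[OF this] obtain u :: "nat \<Rightarrow> ereal" where u: "decseq u"
    "range u \<subseteq> F ` {x. F x < \<infinity>}" "Inf (F ` {x. F x < \<infinity>}) = (INF i. u i)" by auto
  have u_mem: "u n \<in> F ` {x. F x < \<infinity>}" for n using u(2) by (rule subsetD) simp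
  then have "u 0 < \<infinity>" by (metis (mono_tags, lifting) imageE mem_Collect_eq)
  then obtain r where r: "u 0 \<le> ereal r" by (cases "u 0") auto
  have "(\<Inter>n. {x. F x \<le> u n}) \<noteq> {}"
  proof (rule decseq_closed_convex_bounded_Inter)
    show "decseq (\<lambda>n. {x. F x \<le> u n})" using u(1) by (fastforce simp: decseq_def)
    show "bounded {x. F x \<le> u 0}" by (rule bounded_subset[OF bdd[of r]]) (use r in auto)
    show "{x. F x \<le> u n} \<noteq> {}" for n using u_mem[of n] by auto
  qed (use assms lsc_closed_sublevel ext_convex_convex_sublevel in auto)
  then obtain x where x: "\<And>n. F x \<le> u n" by blast
  have "F x \<le> F y" for y
  proof (cases "F y < \<infinity>")
    case True
    have "F x \<le> Inf (F ` {x. F x < \<infinity>})" unfolding u(3) using x by (rule INF_greatest)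
    also have "\<dots> \<le> F y" using True by (auto intro: INF_lower)
    finally show ?thesis .
  qed auto
  then show ?thesis by (auto simp: is_arg_min_def not_less)
qed

section \<open>The form \<open>U_inner\<close>\<close>

context
  fixes A :: "'v::real_inner \<Rightarrow> 'w::real_inner"
  assumes lin: "linear A"
begin

lemma U_inner_commute: "U_inner A \<gamma> x y = U_inner A \<gamma> y x"
  by (simp add: U_inner_def inner_commute)

lemma U_inner_add_left: "U_inner A \<gamma> (x + y) z = U_inner A \<gamma> x z + U_inner A \<gamma> y z"
  by (simp add: U_inner_def linear_add[OF lin] algebra_simps)

lemma U_inner_diff_left: "U_inner A \<gamma> (x - y) z = U_inner A \<gamma> x z - U_inner A \<gamma> y z"
  by (simp add: U_inner_def linear_diff[OF lin] algebra_simps)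

lemma U_inner_scaleR_left: "U_inner A \<gamma> (k *\<^sub>R x) z = k * U_inner A \<gamma> x z"
  by (simp add: U_inner_def linear_scale[OF lin] algebra_simps)

lemma U_inner_add_right: "U_inner A \<gamma> x (y + z) = U_inner A \<gamma> x y + U_inner A \<gamma> x z"
  by (metis U_inner_commute U_inner_add_left)

lemma U_inner_scaleR_right: "U_inner A \<gamma> x (k *\<^sub>R z) = k * U_inner A \<gamma> x z"
  by (metis U_inner_commute U_inner_scaleR_left)

lemmas U_inner_linear = U_inner_add_left U_inner_diff_left U_inner_scaleR_left
  U_inner_add_right U_inner_scaleR_right

lemma U_inner_self: "U_inner A \<gamma> x x = (norm (A x))\<^sup>2 - \<gamma> * (norm x)\<^sup>2"
  by (simp add: U_inner_def power2_norm_eq_inner)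

lemma gram_ge_U_inner_nonneg: "gram_ge A \<gamma> \<Longrightarrow> 0 \<le> U_inner A \<gamma> x x"
  by (simp add: U_inner_self gram_ge_def)

lemma gram_gt_U_inner_pos: "gram_gt A \<gamma> \<Longrightarrow> x \<noteq> 0 \<Longrightarrow> 0 < U_inner A \<gamma> x x"
  by (simp add: U_inner_self gram_gt_def)

lemma U_norm_sq: "gram_ge A \<gamma> \<Longrightarrow> (U_norm A \<gamma> x)\<^sup>2 = U_inner A \<gamma> x x"
  by (simp add: U_norm_def gram_ge_U_inner_nonneg)

text \<open>The projection property is carried along because the induction step replaces the new vector by
  its component orthogonal to the span, as in the Gram-Schmidt process.\<close>

lemma U_inner_span_coercive:
  assumes "finite B" and gt: "gram_gt A \<gamma>"
  shows "(\<forall>b. \<exists>p\<in>span B. \<forall>y\<in>span B. U_inner A \<gamma> (b - p) y = 0) \<and>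
    (\<exists>C\<ge>0. \<forall>x\<in>span B. (norm x)\<^sup>2 \<le> C * U_inner A \<gamma> x x)"
  using \<open>finite B\<close>
proof (induction B)
  case empty
  show ?case by (auto simp: U_inner_def linear_0[OF lin] intro: exI[of _ 0])
next
  case (insert b B)
  let ?U = "U_inner A \<gamma>"
  from insert.IH obtain p where p: "p \<in> span B" "\<And>y. y \<in> span B \<Longrightarrow> ?U (b - p) y = 0" by blast
  from insert.IH obtain C where C: "C \<ge> 0" "\<And>x. x \<in> span B \<Longrightarrow> (norm x)\<^sup>2 \<le> C * ?U x x" by blast
  define e where "e = b - p"
  have orth: "?U e y = 0" "?U y e = 0" if "y \<in> span B" for y
    using p(2)[OF that] U_inner_commute by (simp_all add: e_def)
  have b_span: "b \<in> span (insert b B)" by (simp add: span_base)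
  have mono: "span B \<subseteq> span (insert b B)" by (rule span_mono) auto
  have e_span: "e \<in> span (insert b B)" unfolding e_def using b_span p(1) mono by (auto intro: span_diff)
  have decomp: "\<exists>y\<in>span B. \<exists>k. x = y + k *\<^sub>R e" if "x \<in> span (insert b B)" for x
  proof -
    from that obtain k where "x - k *\<^sub>R b \<in> span B" by (auto simp: span_insert)
    then have "(x - k *\<^sub>R b) + k *\<^sub>R p \<in> span B" using p(1) by (intro span_add span_scale)
    moreover have "x = ((x - k *\<^sub>R b) + k *\<^sub>R p) + k *\<^sub>R e" by (simp add: e_def algebra_simps)
    ultimately show ?thesis by blast
  qed
  show ?case
  proof (cases "e = 0")
    case True
    then have "b \<in> span B" using p(1) by (simp add: e_def)
    then have "span (insert b B) = span B" by (rule span_redundant)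
    then show ?thesis using insert.IH by simp
  next
    case False
    then have Ue: "?U e e > 0" by (rule gram_gt_U_inner_pos[OF gt])
    show ?thesis
    proof (intro conjI allI)
      fix z
      from insert.IH obtain q where q: "q \<in> span B" "\<And>y. y \<in> span B \<Longrightarrow> ?U (z - q) y = 0" by blast
      \<comment> \<open>As \<open>e\<close> is orthogonal to \<open>span B\<close> with respect to
        \<open>?U\<close>, adding the component along \<open>e\<close> to the projection onto
        \<open>span B\<close> gives the projection onto the larger span.\<close>
      let ?q = "q + (?U z e / ?U e e) *\<^sub>R e"
      have "?q \<in> span (insert b B)" using q(1) mono e_span by (auto intro: span_add span_scale)
      moreover have "?U (z - ?q) x = 0" if x: "x \<in> span (insert b B)" for x
      proof -
        obtain y k where y: "y \<in> span B" "x = y + k *\<^sub>R e" using decomp[OF x] by blast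
        then show ?thesis using Ue q(2)[OF y(1)] orth[OF q(1)] orth[OF y(1)]
          by (simp add: U_inner_linear)
      qed
      ultimately show "\<exists>p\<in>span (insert b B). \<forall>y\<in>span (insert b B). ?U (z - p) y = 0" by blast
    next
      \<comment> \<open>\<open>C\<close> controls the part \<open>y\<close> in
        \<open>span B\<close>, the quotient the part along \<open>e\<close>. The factors 2 appear
        because \<open>y\<close> and \<open>e\<close> are orthogonal for \<open>?U\<close>, but need
        not be so for \<open>inner\<close>.\<close>
      let ?D = "2 * C + 2 * (norm e)\<^sup>2 / ?U e e"
      have "(norm x)\<^sup>2 \<le> ?D * ?U x x" if x: "x \<in> span (insert b B)" for x
      proof -
        obtain y k where y: "y \<in> span B" "x = y + k *\<^sub>R e" using decomp[OF x] by blast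
        have U0: "0 \<le> ?U y y" using gram_gt_U_inner_pos[OF gt, of y]
          by (cases "y = 0") (auto simp: U_inner_def linear_0[OF lin])
        have Ux: "?U x x = ?U y y + k\<^sup>2 * ?U e e"
          by (simp add: y(2) U_inner_linear orth[OF y(1)] power2_eq_square)
        \<comment> \<open>The added square completes the parallelogram law, in which the mixed terms
          cancel.\<close>
        have "(norm x)\<^sup>2 \<le> (norm x)\<^sup>2 + (norm (y - k *\<^sub>R e))\<^sup>2" by simp
        also have "\<dots> = 2 * (norm y)\<^sup>2 + 2 * (k\<^sup>2 * (norm e)\<^sup>2)"
          unfolding y(2) power2_norm_eq_inner by (simp add: algebra_simps power2_eq_square)
        also have "\<dots> \<le> 2 * (C * ?U y y) + 2 * (norm e)\<^sup>2 / ?U e e * (k\<^sup>2 * ?U e e)"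
          using C(2)[OF y(1)] Ue by simp
        also have "\<dots> \<le> 2 * (C * ?U x x) + 2 * (norm e)\<^sup>2 / ?U e e * ?U x x"
          using C(1) Ue U0 unfolding Ux by (intro add_mono mult_left_mono) auto
        finally show ?thesis by (simp add: algebra_simps)
      qed
      moreover have "0 \<le> ?D" using C(1) Ue by simp
      ultimately show "\<exists>C\<ge>0. \<forall>x\<in>span (insert b B). (norm x)\<^sup>2 \<le> C * ?U x x" by blast
    qed
  qed
qed

text \<open>Coercivity of \<open>U_inner\<close> on the span of \<open>B\<close> turns the pointwise
  strict inequality into a uniform gap.\<close>

lemma gram_gt_finite_dim:
  assumes "finite B" "span B = (UNIV :: 'v set)" "gram_gt A \<gamma>"
  shows "\<exists>\<delta>>\<gamma>. gram_ge A \<delta>"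
proof -
  obtain C where C: "C \<ge> 0" "\<And>x. (norm x)\<^sup>2 \<le> C * U_inner A \<gamma> x x"
    using U_inner_span_coercive[OF assms(1,3)] assms(2) by auto
  \<comment> \<open>Adding 1 keeps the divisor positive when \<open>C\<close> is 0.\<close>
  have "gram_ge A (\<gamma> + 1 / (C + 1))"
    unfolding gram_ge_def
  proof
    fix x
    have "0 \<le> U_inner A \<gamma> x x"
      using gram_gt_U_inner_pos[OF assms(3), of x]
      by (cases "x = 0") (auto simp: U_inner_def linear_0[OF lin])
    then have "(norm x)\<^sup>2 \<le> (C + 1) * U_inner A \<gamma> x x" using C(2)[of x] by (simp add: algebra_simps)
    then have "1 / (C + 1) * (norm x)\<^sup>2 \<le> U_inner A \<gamma> x x" using C(1) by (simp add: field_simps)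
    then show "(\<gamma> + 1 / (C + 1)) * (norm x)\<^sup>2 \<le> (norm (A x))\<^sup>2"
      by (simp add: U_inner_self distrib_right)
  qed
  then show ?thesis using C(1) by (intro exI[of _ "\<gamma> + 1 / (C + 1)"]) auto
qed

text \<open>The Hessian of \<open>p\<close> is the constant form \<open>U_inner\<close>, so the
  defect in the convexity inequality is an exact multiple of that form and does not depend on
  \<open>w\<close>.\<close>

lemma quadratic_convex_combination:
  fixes x y w :: 'v and d :: 'w and \<gamma> t :: real
  defines "p \<equiv> \<lambda>z. 1 / 2 * (norm (A z - d))\<^sup>2 - \<gamma> / 2 * (norm (w - z))\<^sup>2"
  shows "p (t *\<^sub>R x + (1 - t) *\<^sub>R y) + 1 / 2 * t * (1 - t) * U_inner A \<gamma> (x - y) (x - y)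
    = t * p x + (1 - t) * p y"
proof -
  \<comment> \<open>Stated for any inner product space, because it is used both in \<open>'w\<close>
    and in \<open>'v\<close>.\<close>
  have sq: "(norm (t *\<^sub>R a + (1 - t) *\<^sub>R b))\<^sup>2 + t * (1 - t) * (norm (a - b))\<^sup>2
      = t * (norm a)\<^sup>2 + (1 - t) * (norm b)\<^sup>2" for a b :: "'x::real_inner"
    unfolding power2_norm_eq_inner
    by (simp add: inner_simps inner_commute[of b a]) algebra
  have 1: "A (t *\<^sub>R x + (1 - t) *\<^sub>R y) - d = t *\<^sub>R (A x - d) + (1 - t) *\<^sub>R (A y - d)"
    unfolding linear_add[OF lin] linear_scale[OF lin] by (simp add: algebra_simps)
  have 2: "w - (t *\<^sub>R x + (1 - t) *\<^sub>R y) = t *\<^sub>R (w - x) + (1 - t) *\<^sub>R (w - y)"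
    by (simp add: algebra_simps)
  have 3: "A (x - y) = (A x - d) - (A y - d)" by (simp add: linear_diff[OF lin])
  have 4: "norm (x - y) = norm ((w - x) - (w - y))" by (simp add: norm_minus_commute)
  show ?thesis
    using sq[of "A x - d" "A y - d"] sq[of "w - x" "w - y"]
    unfolding p_def 1 2 U_inner_self 3 4 by algebra
qed

end

section \<open>The transform \<open>S2_trans\<close>\<close>

text \<open>The point \<open>y\<close> is admissible in the supremum for
  \<open>S_trans \<gamma> f w\<close>, which bounds every term of the outer supremum, as in the
  Fenchel-Young inequality.\<close>

lemma S2_trans_le: "S2_trans \<gamma> f y \<le> f y"
  unfolding S2_trans_def comp_def S_trans_def[of \<gamma> "S_trans \<gamma> f"]
proof (rule SUP_least)
  fix w
  have "- f y - ereal (\<gamma> / 2 * (norm (y - w))\<^sup>2) \<le> S_trans \<gamma> f w"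
    unfolding S_trans_def by (rule SUP_upper) simp
  then show "- S_trans \<gamma> f w - ereal (\<gamma> / 2 * (norm (w - y))\<^sup>2) \<le> f y"
    by (cases "f y"; cases "S_trans \<gamma> f w") (auto simp: norm_minus_commute)
qed

text \<open>For nonnegative \<open>f\<close> the inner supremum is at most 0, and the penalty in the
  outer one vanishes at the point \<open>y\<close> itself.\<close>

lemma S2_trans_nonneg:
  assumes "\<And>x. 0 \<le> f x" "\<gamma> \<ge> 0"
  shows "0 \<le> S2_trans \<gamma> f y"
proof -
  have "S_trans \<gamma> f y \<le> 0"
    unfolding S_trans_def
  proof (rule SUP_least)
    fix x show "- f x - ereal (\<gamma> / 2 * (norm (x - y))\<^sup>2) \<le> 0"
      using assms(1)[of x] mult_nonneg_nonneg[OF assms(2) zero_le_power2[of "norm (x - y)"]]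
      by (cases "f x") auto
  qed
  then have "0 \<le> - S_trans \<gamma> f y - ereal (\<gamma> / 2 * (norm (y - y))\<^sup>2)"
    by (simp flip: zero_ereal_def)
  also have "\<dots> \<le> S2_trans \<gamma> f y"
    unfolding S2_trans_def comp_def S_trans_def[of \<gamma> "S_trans \<gamma> f"] by (rule SUP_upper) simp
  finally show ?thesis .
qed

text \<open>Inside the supremum the data term can compensate the concave penalty for each
  \<open>w\<close> separately. Only \<open>- S_trans \<gamma> f w\<close> may be infinite, and it
  does not depend on \<open>x\<close>.\<close>

lemma plus_lsq_S2_trans_eq_SUP:
  "plus_lsq (S2_trans \<gamma> f) A d x =
    (SUP w. - S_trans \<gamma> f w + ereal (1 / 2 * (norm (A x - d))\<^sup>2 - \<gamma> / 2 * (norm (w - x))\<^sup>2))"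
proof -
  have "plus_lsq (S2_trans \<gamma> f) A d x =
      (SUP w. (- S_trans \<gamma> f w - ereal (\<gamma> / 2 * (norm (w - x))\<^sup>2)) + ereal (1 / 2 * (norm (A x - d))\<^sup>2))"
    unfolding plus_lsq_def S2_trans_def comp_def S_trans_def[of \<gamma> "S_trans \<gamma> f"]
    by (rule SUP_ereal_add_left[symmetric]) auto
  also have "(\<lambda>w. (- S_trans \<gamma> f w - ereal (\<gamma> / 2 * (norm (w - x))\<^sup>2)) + ereal (1 / 2 * (norm (A x - d))\<^sup>2))
    = (\<lambda>w. - S_trans \<gamma> f w + ereal (1 / 2 * (norm (A x - d))\<^sup>2 - \<gamma> / 2 * (norm (w - x))\<^sup>2))"
  proof
    fix w show "(- S_trans \<gamma> f w - ereal (\<gamma> / 2 * (norm (w - x))\<^sup>2)) + ereal (1 / 2 * (norm (A x - d))\<^sup>2)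
      = - S_trans \<gamma> f w + ereal (1 / 2 * (norm (A x - d))\<^sup>2 - \<gamma> / 2 * (norm (w - x))\<^sup>2)"
      by (cases "S_trans \<gamma> f w") auto
  qed
  finally show ?thesis .
qed

text \<open>A strict lower bound at \<open>x\<close> is witnessed by a single \<open>w\<close>,
  whose term is continuous and so exceeds the bound nearby.\<close>

lemma lsc_plus_lsq_S2_trans:
  assumes "bounded_linear A"
  shows "lsc (plus_lsq (S2_trans \<gamma> f) A d)"
  unfolding lsc_def
proof (intro allI impI)
  fix x a
  define p where "p w z = 1 / 2 * (norm (A z - d))\<^sup>2 - \<gamma> / 2 * (norm (w - z))\<^sup>2" for w z
  note eq = plus_lsq_S2_trans_eq_SUP[of \<gamma> f A d, folded p_def]
  assume "a < plus_lsq (S2_trans \<gamma> f) A d x"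
  then obtain w where w: "a < - S_trans \<gamma> f w + ereal (p w x)" by (auto simp: eq less_SUP_iff)
  have "((\<lambda>z. p w z) \<longlongrightarrow> p w x) (nhds x)"
    unfolding p_def by (intro tendsto_intros bounded_linear.tendsto[OF assms] filterlim_ident)
  then have "((\<lambda>z. - S_trans \<gamma> f w + ereal (p w z)) \<longlongrightarrow> - S_trans \<gamma> f w + ereal (p w x)) (nhds x)"
    by (cases "S_trans \<gamma> f w") (auto intro!: tendsto_intros)
  from order_tendstoD(1)[OF this w]
  show "eventually (\<lambda>z. a < plus_lsq (S2_trans \<gamma> f) A d z) (nhds x)"
    by eventually_elim (auto simp: eq less_SUP_iff)
qed

text \<open>All terms of the supremum share the same convexity defect, so it can be moved to the
  right before the supremum is taken.\<close>

lemma plus_lsq_S2_trans_convex_combination: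
  fixes d :: "'w::real_inner"
  assumes "linear A" "gram_ge A \<gamma>" and f: "\<And>x. 0 \<le> f x" and "\<gamma> \<ge> 0" and t: "0 < t" "t < 1"
  defines "F \<equiv> plus_lsq (S2_trans \<gamma> f) A d"
  shows "F (t *\<^sub>R x + (1 - t) *\<^sub>R y) + ereal (1 / 2 * t * (1 - t) * U_inner A \<gamma> (x - y) (x - y))
    \<le> ereal t * F x + ereal (1 - t) * F y"
proof -
  define p where "p w z = 1 / 2 * (norm (A z - d))\<^sup>2 - \<gamma> / 2 * (norm (w - z))\<^sup>2" for w z
  note eq = plus_lsq_S2_trans_eq_SUP[of \<gamma> f A d, folded p_def F_def]
  have F0: "0 \<le> F z" for z
    unfolding F_def plus_lsq_def using S2_trans_nonneg[where f = f, OF f \<open>\<gamma> \<ge> 0\<close>] by simp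
  show ?thesis
  \<comment> \<open>Nonnegativity of \<open>F\<close> excludes \<open>-\<infinity>\<close>: one
    infinite value makes the right-hand side \<open>\<infinity>\<close>, and otherwise both values
    are real.\<close>
  proof (cases "F x = \<infinity> \<or> F y = \<infinity>")
    case True
    then have "ereal t * F x + ereal (1 - t) * F y = \<infinity>"
      using t F0[of x] F0[of y] by (cases "F x"; cases "F y") auto
    then show ?thesis by (simp only: ereal_less_eq(1))
  next
    case False
    then obtain a b where a: "F x = ereal a" and b: "F y = ereal b"
      using F0[of x] F0[of y] by (cases "F x"; cases "F y") auto
    let ?u = "1 / 2 * t * (1 - t) * U_inner A \<gamma> (x - y) (x - y)"
    have "F (t *\<^sub>R x + (1 - t) *\<^sub>R y) \<le> ereal (t * a + (1 - t) * b - ?u)"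
      unfolding eq
    proof (rule SUP_least)
      fix w
      have xy: "- S_trans \<gamma> f w + ereal (p w x) \<le> ereal a" "- S_trans \<gamma> f w + ereal (p w y) \<le> ereal b"
        unfolding a[symmetric] b[symmetric] eq by (rule SUP_upper, simp)+
      show "- S_trans \<gamma> f w + ereal (p w (t *\<^sub>R x + (1 - t) *\<^sub>R y)) \<le> ereal (t * a + (1 - t) * b - ?u)"
      \<comment> \<open>The value \<open>\<infinity>\<close> makes the term
        \<open>-\<infinity>\<close>, and the value \<open>-\<infinity>\<close> contradicts
        \<open>xy\<close>.\<close>
      proof (cases "S_trans \<gamma> f w")
        case (real c)
        have "t * (p w x - c) \<le> t * a" "(1 - t) * (p w y - c) \<le> (1 - t) * b"
          using xy t real by (auto intro!: mult_left_mono)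
        then have "t * p w x + (1 - t) * p w y - c \<le> t * a + (1 - t) * b"
          by (simp add: algebra_simps)
        then show ?thesis
          using quadratic_convex_combination[OF \<open>linear A\<close>, where d = d and \<gamma> = \<gamma> and w = w and t = t and x = x and y = y] real by (simp add: p_def)
      qed (use xy in auto)
    qed
    then show ?thesis unfolding a b by (cases "F (t *\<^sub>R x + (1 - t) *\<^sub>R y)") auto
  qed
qed

text \<open>The strict inequality provides a modulus for \<open>U_norm\<close>; one for
  \<open>norm\<close> is derived from finite dimension or a uniform gap. If \<open>f\<close> were
  identically \<open>\<infinity>\<close>, every point would be a minimizer of
  \<open>J\<gamma>\<close>.\<close>

theorem theorem4p4:
  fixes A :: "'v::{real_inner, complete_space} \<Rightarrow> 'w::{real_inner, complete_space}"
    and d :: 'w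
    and f :: "'v \<Rightarrow> ereal"
    and J J\<gamma> :: "'v \<Rightarrow> ereal"
    and \<gamma> :: real
  assumes "separable_space (euclidean :: 'v topology)"
    and "separable_space (euclidean :: 'w topology)"
    and "bounded_linear A"
    and "\<And>x. 0 \<le> f x"
    and J_def: "J = plus_lsq f A d"
    and J\<gamma>_def: "J\<gamma> = plus_lsq (S2_trans \<gamma> f) A d"
    and "\<gamma> > 0"
    and "gram_ge A \<gamma>"
  shows "ext_convex J\<gamma> \<and>
    (\<forall>x. J\<gamma> x \<le> CE J x) \<and>
    (gram_gt A \<gamma> \<longrightarrow>
       strongly_convex_wrt (U_norm A \<gamma>) J\<gamma> \<and>
       ((\<exists>B :: 'v set. finite B \<and> span B = UNIV) \<or> (\<exists>\<delta>>\<gamma>. gram_ge A \<delta>)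
          \<longrightarrow> strongly_convex_wrt norm J\<gamma>) \<and>
       ((\<exists>x. f x \<noteq> \<infinity>) \<longrightarrow> (\<exists>!x. minimizer J\<gamma> x))) \<and>
    (\<forall>xhat. minimizer J\<gamma> xhat \<and> f xhat = S2_trans \<gamma> f xhat \<longrightarrow> minimizer J xhat)"
proof -
  note f0 = assms(4)
  have \<gamma>0: "0 \<le> \<gamma>" using \<open>\<gamma> > 0\<close> by simp
  have lin: "linear A" using assms(3) by (rule bounded_linear.linear)
  have U0: "0 \<le> U_inner A \<gamma> x x" for x by (rule gram_ge_U_inner_nonneg[OF lin \<open>gram_ge A \<gamma>\<close>])
  \<comment> \<open>Source of convexity, of both forms of strong convexity and of
    uniqueness.\<close>
  have comb: "J\<gamma> (t *\<^sub>R x + (1 - t) *\<^sub>R y) + ereal (1 / 2 * t * (1 - t) * U_inner A \<gamma> (x - y) (x - y))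
      \<le> ereal t * J\<gamma> x + ereal (1 - t) * J\<gamma> y" if "0 < t" "t < 1" for t x y
    unfolding J\<gamma>_def
    by (rule plus_lsq_S2_trans_convex_combination[OF lin \<open>gram_ge A \<gamma>\<close> f0 \<gamma>0 that])
  have lsq: "ereal (1 / 2 * (norm (A x - d))\<^sup>2) \<le> J\<gamma> x" for x
    unfolding J\<gamma>_def plus_lsq_def using S2_trans_nonneg[where f = f and y = x, OF f0 \<gamma>0]
    by (metis add_0 add_right_mono)
  have nonneg: "0 \<le> J\<gamma> x" for x
    using lsq[of x] by (rule order_trans[rotated]) (simp add: zero_ereal_def)
  have lsc: "lsc J\<gamma>" unfolding J\<gamma>_def by (rule lsc_plus_lsq_S2_trans[OF assms(3)])
  have conv: "ext_convex J\<gamma>"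
    unfolding ext_convex_def
  proof (rule convexI, clarsimp)
    fix x y :: 'v and r s t u :: real
    assume le: "J\<gamma> x \<le> ereal r" "J\<gamma> y \<le> ereal s" and t: "0 \<le> t" "0 \<le> u" "t + u = 1"
    then have u: "u = 1 - t" by simp
    \<comment> \<open>\<open>comb\<close> covers the open interval only; the endpoints follow from
      \<open>le\<close>.\<close>
    consider "t = 0" | "t = 1" | "0 < t" "t < 1" using t by linarith
    then show "J\<gamma> (t *\<^sub>R x + u *\<^sub>R y) \<le> ereal (t * r + u * s)"
    proof cases
      case 3
      have "J\<gamma> (t *\<^sub>R x + (1 - t) *\<^sub>R y) \<le>
          J\<gamma> (t *\<^sub>R x + (1 - t) *\<^sub>R y) + ereal (1 / 2 * t * (1 - t) * U_inner A \<gamma> (x - y) (x - y))"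
        using U0[of "x - y"] 3 by (intro ereal_le_add_self) simp
      also have "\<dots> \<le> ereal t * J\<gamma> x + ereal (1 - t) * J\<gamma> y" using 3 by (rule comb)
      also have "\<dots> \<le> ereal t * ereal r + ereal (1 - t) * ereal s"
        using le 3 by (intro add_mono ereal_mult_left_mono) auto
      finally show ?thesis by (simp add: u)
    qed (use le u in auto)
  qed
  have le_J: "J\<gamma> x \<le> J x" for x
    unfolding J\<gamma>_def J_def plus_lsq_def by (intro add_right_mono S2_trans_le)
  \<comment> \<open>\<open>J\<gamma>\<close> is itself a lower semi-continuous convex minorant of
    \<open>J\<close>.\<close>
  then have "J\<gamma> \<le> CE J" by (intro CE_greatest lsc conv le_funI)
  then have le_CE: "\<forall>x. J\<gamma> x \<le> CE J x" by (simp add: le_fun_def)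
  \<comment> \<open>With respect to \<open>U_norm\<close>, \<open>comb\<close> is the definition
    with modulus 1.\<close>
  have strongU: "strongly_convex_wrt (U_norm A \<gamma>) J\<gamma>"
    unfolding strongly_convex_wrt_def U_norm_sq[OF lin \<open>gram_ge A \<gamma>\<close>]
    by (intro exI[of _ 1] conjI allI ballI comb) auto
  have strong: "strongly_convex_wrt norm J\<gamma>" if "\<delta> > \<gamma>" "gram_ge A \<delta>" for \<delta>
    unfolding strongly_convex_wrt_def
  \<comment> \<open>The modulus is the gap, by which the form \<open>U_inner A \<gamma>\<close>
    dominates the squared norm.\<close>
  proof (intro exI[of _ "\<delta> - \<gamma>"] conjI allI ballI)
    fix x y :: 'v and t :: real assume t: "t \<in> {0<..<1}"
    have "(\<delta> - \<gamma>) * (norm (x - y))\<^sup>2 \<le> U_inner A \<gamma> (x - y) (x - y)"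
      using that(2) by (simp add: U_inner_self[OF lin] gram_ge_def left_diff_distrib)
    then have "t * (1 - t) / 2 * ((\<delta> - \<gamma>) * (norm (x - y))\<^sup>2)
        \<le> t * (1 - t) / 2 * U_inner A \<gamma> (x - y) (x - y)"
      using t by (intro mult_left_mono) auto
    then have "ereal ((\<delta> - \<gamma>) / 2 * t * (1 - t) * (norm (x - y))\<^sup>2)
        \<le> ereal (1 / 2 * t * (1 - t) * U_inner A \<gamma> (x - y) (x - y))"
      by (simp add: mult_ac)
    then have "J\<gamma> (t *\<^sub>R x + (1 - t) *\<^sub>R y) + ereal ((\<delta> - \<gamma>) / 2 * t * (1 - t) * (norm (x - y))\<^sup>2)
      \<le> J\<gamma> (t *\<^sub>R x + (1 - t) *\<^sub>R y) + ereal (1 / 2 * t * (1 - t) * U_inner A \<gamma> (x - y) (x - y))"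
      by (rule add_left_mono)
    also have "\<dots> \<le> ereal t * J\<gamma> x + ereal (1 - t) * J\<gamma> y" using t by (intro comb) auto
    finally show "J\<gamma> (t *\<^sub>R x + (1 - t) *\<^sub>R y) + ereal ((\<delta> - \<gamma>) / 2 * t * (1 - t) * (norm (x - y))\<^sup>2)
      \<le> ereal t * J\<gamma> x + ereal (1 - t) * J\<gamma> y" .
  qed (use that in auto)
  \<comment> \<open>Existence rests on the coercivity given by \<open>gram_ge\<close>, uniqueness on
    the positivity of \<open>U_inner\<close>; both work in infinite dimension without a modulus for
    \<open>norm\<close>.\<close>
  have unique: "\<exists>!x. minimizer J\<gamma> x" if gt: "gram_gt A \<gamma>" and "f x0 \<noteq> \<infinity>" for x0
  proof -
    have fin: "J\<gamma> x0 \<noteq> \<infinity>"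
      using le_J[of x0] \<open>f x0 \<noteq> \<infinity>\<close> by (auto simp: J_def plus_lsq_def)
    have "bounded {x. J\<gamma> x \<le> ereal r}" for r
    proof -
      \<comment> \<open>\<open>lsq\<close> bounds the residual \<open>A x - d\<close>, hence
        \<open>A x\<close>, and \<open>gram_ge\<close> passes the bound on to
        \<open>x\<close>.\<close>
      have "norm x \<le> (sqrt (2 * r) + norm d) / sqrt \<gamma>" if "J\<gamma> x \<le> ereal r" for x
      proof -
        have "(norm (A x - d))\<^sup>2 \<le> 2 * r" using order_trans[OF lsq that] by simp
        then have "norm (A x - d) \<le> sqrt (2 * r)" by (rule real_le_rsqrt)
        then have "norm (A x) \<le> sqrt (2 * r) + norm d" using norm_triangle_sub[of "A x" d] by simp
        moreover have "sqrt \<gamma> * norm x \<le> norm (A x)"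
          using \<open>gram_ge A \<gamma>\<close> \<gamma>0 unfolding gram_ge_def
          by (intro power2_le_imp_le[OF _ norm_ge_zero]) (simp add: power_mult_distrib)
        ultimately have "norm x * sqrt \<gamma> \<le> sqrt (2 * r) + norm d" by (simp only: mult.commute)
        then show ?thesis using \<open>\<gamma> > 0\<close> by (simp add: pos_le_divide_eq)
      qed
      then show ?thesis by (auto simp: bounded_iff)
    qed
    from ext_convex_minimizer_exists[OF lsc conv this fin]
    obtain x where x: "minimizer J\<gamma> x" by blast
    moreover have "y = x" if y: "minimizer J\<gamma> y" for y
    proof (rule ccontr)
      assume "y \<noteq> x"
      then have pos: "0 < U_inner A \<gamma> (x - y) (x - y)" by (intro gram_gt_U_inner_pos[OF lin gt]) simp
      have min: "J\<gamma> x \<le> J\<gamma> z" "J\<gamma> y \<le> J\<gamma> z" for z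
        using x y by (auto simp: is_arg_min_def not_less)
      have "J\<gamma> y = J\<gamma> x" using min by (intro antisym)
      moreover obtain a where "J\<gamma> x = ereal a"
        using nonneg[of x] min(1)[of x0] fin by (cases "J\<gamma> x") auto
      ultimately have a: "J\<gamma> x = ereal a" "J\<gamma> y = ereal a" by auto
      \<comment> \<open>At the midpoint of two distinct minimizers \<open>comb\<close> forces a
        value below the minimum, by one eighth of the positive \<open>U_inner\<close> of their
        difference.\<close>
      let ?m = "(1/2) *\<^sub>R x + (1 - 1/2) *\<^sub>R y"
      have "J\<gamma> ?m + ereal (1 / 2 * (1/2) * (1 - 1/2) * U_inner A \<gamma> (x - y) (x - y)) \<le> ereal a"
        using comb[where t = "1/2" and x = x and y = y] a by simp
      then show False using min(1)[of ?m] pos a by (cases "J\<gamma> ?m") auto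
    qed
    ultimately show ?thesis by blast
  qed
  have last: "minimizer J z" if "minimizer J\<gamma> z" "f z = S2_trans \<gamma> f z" for z
  proof -
    have "J z \<le> J y" for y
    proof -
      have "J z = J\<gamma> z" by (simp add: J_def J\<gamma>_def plus_lsq_def that(2))
      also have "\<dots> \<le> J\<gamma> y" using that(1) by (simp add: is_arg_min_def not_less)
      finally show ?thesis using le_J order_trans by blast
    qed
    then show ?thesis by (auto simp: is_arg_min_def not_less)
  qed
  have strong': "strongly_convex_wrt norm J\<gamma>"
    if "gram_gt A \<gamma>" "(\<exists>B :: 'v set. finite B \<and> span B = UNIV) \<or> (\<exists>\<delta>>\<gamma>. gram_ge A \<delta>)"
    using that gram_gt_finite_dim[OF lin] strong by metis
  have unique': "\<exists>!x. minimizer J\<gamma> x" if "gram_gt A \<gamma>" "\<exists>x. f x \<noteq> \<infinity>"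
    using that unique by blast
  show ?thesis
    by (intro conjI impI allI; (elim conjE)?) (simp_all only: conv le_CE strongU strong' unique' last)
qed

end
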